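(* Let $n,m\ge 1$ be integers and let $W(3,n,m)$ be the generalized weaving link, i.e. the closure of the 3-braid $(\sigma_1^m\sigma_2^{-m})^n$. Put $s=-t$ and $[m]=\frac{1-s^m}{1-s}$. Then the Jones polynomial of $W(3,n,m)$, written in the variable $s$, is $$V_{W(3,n,m)}(s)=-s-s^{-1}+2\,T_n\!\left(\frac{1+[m]^2s+s^{2m}}{2s^m}\right),$$ where $T_n$ is the $n$-th Chebyshev polynomial of the first kind.
   Context: $B_3=\langle\sigma_1,\sigma_2\mid \sigma_1\sigma_2\sigma_1=\sigma_2\sigma_1\sigma_2\rangle$ is the braid group on 3 strands. The (reduced) Burau representation $\psi_t:B_3\to GL(2,\mathbb{Z}[t,t^{-1}])$ is given by $$\psi_t(\sigma_1)=\begin{pmatrix}-t&1\\0&1\end{pmatrix},\qquad \psi_t(\sigma_2)=\begin{pmatrix}1&0\\t&-t\end{pmatrix}.$$ For a 3-braid $\alpha$ with exponent sum $e_\alpha$ (as a word in $\sigma_1,\sigma_2$) and closure $\hat\alpha$, the Jones polynomial (normalized to be $1$ on the unknot) is given by Birman's formula $$V_{\hat\alpha}(t)=(-\sqrt t)^{e_\alpha}\bigl(t+t^{-1}+\operatorname{tr}(\psi_t(\alpha))\bigr).$$ $V_L(s)$ denotes the Jones polynomial rewritten in the variable $s=-t$ (that is, with $t=-s$ substituted). The Chebyshev polynomials of the first kind are defined by $T_0(x)=1$, $T_1(x)=x$, $T_{n+1}(x)=2xT_n(x)-T_{n-1}(x)$. *)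

theory Defs
  imports "HOL-Computational_Algebra.Computational_Algebra"
begin

text \<open>
  A braid on \<open>k\<close> strands is given by a word in the generators and their inverses: the letter
  \<open>(i, True)\<close> stands for $\sigma_i$ and \<open>(i, False)\<close> for $\sigma_i^{-1}$, where $1 \le i < k$.
  The closure is oriented so that all strands run in the same direction, and $\sigma_i$ is a
  positive crossing; hence the writhe of the closed braid diagram is the exponent sum of the word.
\<close>

type_synonym braid_word = "(nat \<times> bool) list"

definition weaving_braid :: "nat \<Rightarrow> nat \<Rightarrow> braid_word" where
  "weaving_braid n m = concat (replicate n (replicate m (1, True) @ replicate m (2, False)))"

definition writhe :: "braid_word \<Rightarrow> int" where
  "writhe w = (\<Sum>x\<leftarrow>w. if snd x then 1 else - 1)"

text \<open>
  A Kauffman state of the closed braid diagram of \<open>w\<close> is a set \<open>S\<close> of crossings, namely those that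
  receive the A-smoothing; all the others receive the B-smoothing. The A-smoothing of $\sigma_i$
  joins the four endpoints vertically (along the braid direction), the B-smoothing joins the two
  lower endpoints with each other and the two upper endpoints with each other; for $\sigma_i^{-1}$
  the two are exchanged.

  The node \<open>(p, j)\<close> is the point on strand position \<open>p\<close> just before the \<open>j\<close>-th letter
  (counted from 0). Each smoothed crossing contributes edges between the levels \<open>j\<close> and \<open>j + 1\<close>,
  and the closing arcs join level \<open>length w\<close> to level 0. The circles of the smoothed diagram are
  the connected components of the resulting graph.
\<close>

definition smoothing_arcs ::
  "nat \<Rightarrow> nat \<Rightarrow> bool \<Rightarrow> nat \<Rightarrow> ((nat \<times> nat) \<times> (nat \<times> nat)) set" where
  "smoothing_arcs k i vertical j =
     (if vertical then {((p, j), (p, Suc j)) | p. p \<in> {1..k}}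
      else {((p, j), (p, Suc j)) | p. p \<in> {1..k} - {i, Suc i}} \<union>
           {((i, j), (Suc i, j)), ((i, Suc j), (Suc i, Suc j))})"

definition state_arcs :: "nat \<Rightarrow> braid_word \<Rightarrow> nat set \<Rightarrow> ((nat \<times> nat) \<times> (nat \<times> nat)) set" where
  "state_arcs k w S =
     (\<Union>j<length w. smoothing_arcs k (fst (w ! j)) (snd (w ! j) \<longleftrightarrow> j \<in> S) j) \<union>
     {((p, length w), (p, 0)) | p. p \<in> {1..k}}"

definition state_circles :: "nat \<Rightarrow> braid_word \<Rightarrow> nat set \<Rightarrow> nat" where
  "state_circles k w S =
     card (({1..k} \<times> {..length w}) // (state_arcs k w S \<union> (state_arcs k w S)\<inverse>)\<^sup>*)"

text \<open>
  The bracket is normalised to be 1 on a circle without crossings.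
\<close>

definition kauffman_bracket :: "'a::field \<Rightarrow> nat \<Rightarrow> braid_word \<Rightarrow> 'a" where
  "kauffman_bracket A k w =
     (\<Sum>S\<in>Pow {..<length w}.
        A powi (int (card S) - int (card ({..<length w} - S))) *
        (- (A ^ 2) - A powi (- 2)) ^ (state_circles k w S - 1))"

text \<open>
  The Jones polynomial is the writhe-normalised bracket at $A = t^{-1/4}$. Polynomials are
  represented in the field of formal Laurent series over the rationals whose indeterminate
  \<open>fls_X\<close> is $t^{1/4}$, so that quotients of Laurent polynomials in $t$ make sense and an equation
  is an identity of formal expressions in $t$.
\<close>

definition jones_var :: "rat fls" where
  "jones_var = fls_X ^ 4"

definition jones_polynomial :: "nat \<Rightarrow> braid_word \<Rightarrow> rat fls" where
  "jones_polynomial k w =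
     (let A = inverse fls_X in (- (A ^ 3)) powi (- writhe w) * kauffman_bracket A k w)"

fun chebyshev_T :: "nat \<Rightarrow> 'a::comm_ring_1 \<Rightarrow> 'a" where
  "chebyshev_T 0 x = 1"
| "chebyshev_T (Suc 0) x = x"
| "chebyshev_T (Suc (Suc n)) x = 2 * x * chebyshev_T (Suc n) x - chebyshev_T n x"

end

theory Submission
  imports Defs
begin

text \<open>
  The Kauffman states of a 3-braid are products of generators of the Temperley-Lieb algebra $TL_3$
  with loop value $\delta = -A^2 - A^{-2}$. The number of circles of a state is found by counting
  its two-colourings that are constant on circles: there are $2^c$ of them, and a transfer matrix
  computes their number level by level. On $TL_3$ the closure $\delta^{c-1}$ equals the trace of
  the two-dimensional representation plus $\delta^2 - 2$ times the one-dimensional character that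
  kills both generators. Summing over the states gives Birman's formula for the bracket, and the
  Chebyshev polynomial appears because the matrix of $\sigma_1^m\sigma_2^{-m}$ has determinant 1.
\<close>

section \<open>Two-by-two matrices\<close>

datatype 'a mat2 = Mat2 (m11: 'a) (m12: 'a) (m21: 'a) (m22: 'a)

instantiation mat2 :: (ring_1) ring_1
begin

definition "0 = Mat2 0 0 0 0"
definition "1 = Mat2 1 0 0 1"
definition "x + y = Mat2 (m11 x + m11 y) (m12 x + m12 y) (m21 x + m21 y) (m22 x + m22 y)"
definition "x - y = Mat2 (m11 x - m11 y) (m12 x - m12 y) (m21 x - m21 y) (m22 x - m22 y)"
definition "- x = Mat2 (- m11 x) (- m12 x) (- m21 x) (- m22 x)"
definition "x * y =
  Mat2 (m11 x * m11 y + m12 x * m21 y) (m11 x * m12 y + m12 x * m22 y)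
       (m21 x * m11 y + m22 x * m21 y) (m21 x * m12 y + m22 x * m22 y)"

instance
  by standard
    (simp_all add: zero_mat2_def one_mat2_def plus_mat2_def minus_mat2_def uminus_mat2_def
      times_mat2_def mat2.expand algebra_simps)

end

definition mat2_trace :: "'a::ring_1 mat2 \<Rightarrow> 'a" where
  "mat2_trace x = m11 x + m22 x"

definition mat2_det :: "'a::comm_ring_1 mat2 \<Rightarrow> 'a" where
  "mat2_det x = m11 x * m22 x - m12 x * m21 x"

text \<open>Scalars enter as central matrices, so scaling is ring multiplication and weights can be
  moved through ordered products.\<close>

definition mat2_scalar :: "'a::comm_ring_1 \<Rightarrow> 'a mat2" where
  "mat2_scalar c = Mat2 c 0 0 c"

lemma mat2_trace_0 [simp]: "mat2_trace 0 = 0"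
  by (simp add: mat2_trace_def zero_mat2_def)

lemma mat2_trace_add [simp]: "mat2_trace (x + y) = mat2_trace x + mat2_trace y"
  by (simp add: mat2_trace_def plus_mat2_def)

lemma mat2_trace_sum: "mat2_trace (\<Sum>x\<in>X. f x) = (\<Sum>x\<in>X. mat2_trace (f x))"
  by (induction X rule: infinite_finite_induct) auto

lemma mat2_trace_scalar_mult: "mat2_trace (mat2_scalar c * x) = c * mat2_trace x"
  by (simp add: mat2_trace_def mat2_scalar_def times_mat2_def algebra_simps)

lemma mat2_scalar_1 [simp]: "mat2_scalar 1 = 1"
  by (simp add: mat2_scalar_def one_mat2_def)

lemma mat2_scalar_mult: "mat2_scalar c * mat2_scalar d = mat2_scalar (c * d)"
  by (simp add: mat2_scalar_def times_mat2_def)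

lemma mat2_scalar_commute: "x * mat2_scalar c = mat2_scalar c * x"
  by (simp add: mat2_scalar_def times_mat2_def algebra_simps)

section \<open>Traces of powers and Chebyshev polynomials\<close>

lemma mat2_det_mult: "mat2_det (x * y) = mat2_det x * mat2_det y"
  by (simp add: mat2_det_def times_mat2_def algebra_simps)

lemma mat2_det_power: "mat2_det (x ^ n) = mat2_det x ^ n"
  by (induction n) (simp_all add: mat2_det_mult, simp add: mat2_det_def one_mat2_def)

text \<open>Cayley-Hamilton, x^2 = (tr x) x - (det x) 1, multiplied by x^n and traced.\<close>

lemma mat2_trace_power_Suc_Suc:
  "mat2_trace (x ^ Suc (Suc n)) =
    mat2_trace x * mat2_trace (x ^ Suc n) - mat2_det x * mat2_trace (x ^ n)"
  by (simp add: mat2_trace_def mat2_det_def times_mat2_def algebra_simps)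

text \<open>With determinant 1 the traces obey the Chebyshev recurrence, starting from 2 and 2c;
  this is T_n(cos \<theta>) = cos(n \<theta>) in algebraic form.\<close>

lemma mat2_trace_power_chebyshev:
  assumes "mat2_det x = 1" and "mat2_trace x = 2 * c"
  shows "mat2_trace (x ^ n) = 2 * chebyshev_T n c"
  using assms(2)
proof (induction n c rule: chebyshev_T.induct)
  case (1 c)
  show ?case by (simp add: mat2_trace_def one_mat2_def)
next
  case (2 c)
  then show ?case by simp
next
  case (3 n c)
  then show ?case
    using assms(1) by (simp only: mat2_trace_power_Suc_Suc) (simp add: algebra_simps)
qed

section \<open>Powers of triangular matrices\<close>

lemma geometric_step:
  fixes a b d :: "'a::field"
  assumes "a \<noteq> d"
  shows "a * (b * (a ^ n - d ^ n) / (a - d)) + b * d ^ n = b * (a ^ Suc n - d ^ Suc n) / (a - d)"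
    and "b * a ^ n + d * (b * (a ^ n - d ^ n) / (a - d)) = b * (a ^ Suc n - d ^ Suc n) / (a - d)"
  using assms by (simp_all add: eq_divide_eq distrib_right) (simp_all add: algebra_simps)

text \<open>The off-diagonal entry is b times the sum of a^i d^(n-1-i). Distinct eigenvalues allow
  the quotient form of this geometric sum, from which [m] arises later.\<close>

lemma mat2_upper_power:
  fixes a b d :: "'a::field"
  assumes "a \<noteq> d"
  shows "Mat2 a b 0 d ^ n = Mat2 (a ^ n) (b * (a ^ n - d ^ n) / (a - d)) 0 (d ^ n)"
proof (induction n)
  case 0
  show ?case by (simp add: one_mat2_def)
next
  case (Suc n)
  then show ?case
    using geometric_step(1)[OF assms, of b n] by (simp add: times_mat2_def)
qed

lemma mat2_lower_power:
  fixes a c d :: "'a::field"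
  assumes "a \<noteq> d"
  shows "Mat2 a 0 c d ^ n = Mat2 (a ^ n) 0 (c * (a ^ n - d ^ n) / (a - d)) (d ^ n)"
proof (induction n)
  case 0
  show ?case by (simp add: one_mat2_def)
next
  case (Suc n)
  then show ?case
    using geometric_step(2)[OF assms, of c n] by (simp add: times_mat2_def)
qed

section \<open>Colourings of a Kauffman state\<close>

text \<open>A set respected by all edges is a union of connected components, and each component may
  be put in or left out independently. This turns the number of circles into a count of
  two-colourings.\<close>

lemma card_saturated_subsets:
  assumes fin: "finite V" and E: "E \<subseteq> V \<times> V"
  shows "card {U. U \<subseteq> V \<and> (\<forall>(x, y)\<in>E. x \<in> U \<longleftrightarrow> y \<in> U)} = 2 ^ card (V // (E \<union> E\<inverse>)\<^sup>*)"
proof -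
  define R where "R = (E \<union> E\<inverse>)\<^sup>*"
  have refl: "(x, x) \<in> R" for x
    by (simp add: R_def)
  have sym: "(y, x) \<in> R" if "(x, y) \<in> R" for x y
    using that unfolding R_def by (rule symD[OF sym_rtrancl[OF sym_Un_converse]])
  have trans: "(x, z) \<in> R" if "(x, y) \<in> R" "(y, z) \<in> R" for x y z
    using that unfolding R_def by (rule rtrancl_trans)
  \<comment> \<open>The closure is reflexive on the whole type, but the class of a point of
    \<open>V\<close> never leaves \<open>V\<close> because every edge has both ends there.\<close>
  have stay: "y \<in> V" if "(x, y) \<in> R" "x \<in> V" for x y
    using that unfolding R_def by (induction rule: rtrancl_induct) (use E in auto)
  have class_eq: "C = R `` {x}" if C: "C \<in> V // R" and x: "x \<in> C" for C x
  proof -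
    obtain y where y: "C = R `` {y}" using C by (rule quotientE)
    then have "(y, x) \<in> R" using x by simp
    then have "(y, z) \<in> R \<longleftrightarrow> (x, z) \<in> R" for z
      using trans[of y x z] trans[of x y z] sym[of y x] by argo
    then show ?thesis using y by auto
  qed
  have closed: "x \<in> U \<longleftrightarrow> y \<in> U"
    if U: "\<forall>(x, y)\<in>E. x \<in> U \<longleftrightarrow> y \<in> U" and xy: "(x, y) \<in> R" for U x y
    using xy unfolding R_def by (induction rule: rtrancl_induct) (use U in auto)
  \<comment> \<open>The inverse of taking unions collects the classes contained in a saturated
    set.\<close>
  have "bij_betw Union (Pow (V // R)) {U. U \<subseteq> V \<and> (\<forall>(x, y)\<in>E. x \<in> U \<longleftrightarrow> y \<in> U)}"
  proof (rule bij_betwI[where g = "\<lambda>U. {C \<in> V // R. C \<subseteq> U}"])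
    show "Union \<in> Pow (V // R) \<rightarrow> {U. U \<subseteq> V \<and> (\<forall>(x, y)\<in>E. x \<in> U \<longleftrightarrow> y \<in> U)}"
    proof (intro funcsetI CollectI conjI)
      fix \<C> assume \<C>: "\<C> \<in> Pow (V // R)"
      show "\<Union>\<C> \<subseteq> V"
        using \<C> stay by (auto simp: quotient_def)
      have "x \<in> \<Union>\<C> \<longleftrightarrow> y \<in> \<Union>\<C>" if "(x, y) \<in> E" for x y
      proof -
        have xy: "(x, y) \<in> R" "(y, x) \<in> R"
          using that by (auto simp: R_def)
        have "y' \<in> \<Union>\<C>" if "x' \<in> C" "C \<in> \<C>" "(x', y') \<in> R" for x' y' C
          using class_eq[of C x'] \<C> that by blast
        then show ?thesis using xy by blast
      qed
      then show "\<forall>(x, y)\<in>E. x \<in> \<Union>\<C> \<longleftrightarrow> y \<in> \<Union>\<C>" by blast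
    qed
    show "{C \<in> V // R. C \<subseteq> \<Union>\<C>} = \<C>" if \<C>: "\<C> \<in> Pow (V // R)" for \<C>
    proof (intro subset_antisym subsetI)
      \<comment> \<open>Classes are nonempty and pairwise disjoint, so a class covered by a union of
        classes is one of them.\<close>
      fix C assume C: "C \<in> {C \<in> V // R. C \<subseteq> \<Union>\<C>}"
      then obtain x where "x \<in> C" using refl by (auto simp: quotient_def)
      moreover then obtain C' where "x \<in> C'" "C' \<in> \<C>" using C by auto
      ultimately show "C \<in> \<C>" using class_eq[of C x] class_eq[of C' x] C \<C> by auto
    qed (use \<C> in auto)
    show "\<Union>{C \<in> V // R. C \<subseteq> U} = U" if U: "U \<in> {U. U \<subseteq> V \<and> (\<forall>(x, y)\<in>E. x \<in> U \<longleftrightarrow> y \<in> U)}" for U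
    proof (intro subset_antisym subsetI)
      fix x assume x: "x \<in> U"
      have "y \<in> U" if "(x, y) \<in> R" for y
        using closed[OF _ that, of U] U x by simp
      then have "R `` {x} \<subseteq> U" by auto
      moreover have "R `` {x} \<in> V // R" using x U by (auto intro: quotientI)
      ultimately show "x \<in> \<Union>{C \<in> V // R. C \<subseteq> U}" using refl[of x] by blast
    qed auto
  qed auto
  then have "card {U. U \<subseteq> V \<and> (\<forall>(x, y)\<in>E. x \<in> U \<longleftrightarrow> y \<in> U)} = card (Pow (V // R))"
    by (rule bij_betw_same_card[symmetric])
  moreover have "finite (V // R)"
  proof (rule finite_subset)
    show "V // R \<subseteq> Pow V" using stay by (auto simp: quotient_def)
  qed (use fin in simp)
  ultimately show ?thesis by (simp add: card_Pow R_def)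
qed

text \<open>
  A smoothing is \<open>None\<close> if it is vertical and \<open>Some i\<close> if it is the Temperley-Lieb generator $e_i$.
  A colour class is recorded on each level by the set of positions that belong to it.
\<close>

fun colours_match :: "nat \<Rightarrow> nat option \<Rightarrow> nat set \<Rightarrow> nat set \<Rightarrow> bool" where
  "colours_match k None a b \<longleftrightarrow> a = b"
| "colours_match k (Some i) a b \<longleftrightarrow>
     (i \<in> a \<longleftrightarrow> Suc i \<in> a) \<and> (i \<in> b \<longleftrightarrow> Suc i \<in> b) \<and>
     (\<forall>p\<in>{1..k} - {i, Suc i}. p \<in> a \<longleftrightarrow> p \<in> b)"

text \<open>The (a, b) entry of a product of \<open>N\<close> transfer matrices with entries 0 and
  1, whose rows and columns are the subsets of {1..k}.\<close>

fun colouring_count :: "nat \<Rightarrow> (nat \<Rightarrow> nat option) \<Rightarrow> nat \<Rightarrow> nat set \<Rightarrow> nat set \<Rightarrow> nat" where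
  "colouring_count k u 0 a b = of_bool (a = b)"
| "colouring_count k u (Suc N) a b =
     (\<Sum>c\<in>Pow {1..k}. colouring_count k u N a c * of_bool (colours_match k (u N) c b))"

definition colour_level :: "(nat \<times> nat) set \<Rightarrow> nat \<Rightarrow> nat set" where
  "colour_level U j = {p. (p, j) \<in> U}"

text \<open>Paths of level sets from \<open>a\<close> to \<open>b\<close>, kept as one set of nodes
  so that they can be compared directly with the saturated sets of the state graph.\<close>

definition colourings ::
  "nat \<Rightarrow> (nat \<Rightarrow> nat option) \<Rightarrow> nat \<Rightarrow> nat set \<Rightarrow> nat set \<Rightarrow> (nat \<times> nat) set set" where
  "colourings k u N a b =
     {U. U \<subseteq> {1..k} \<times> {..N} \<and> colour_level U 0 = a \<and> colour_level U N = b \<and>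
       (\<forall>j<N. colours_match k (u j) (colour_level U j) (colour_level U (Suc j)))}"

lemma finite_colourings [simp]: "finite (colourings k u N a b)"
  by (rule finite_subset[of _ "Pow ({1..k} \<times> {..N})"]) (auto simp: colourings_def)

text \<open>A path of length N + 1 is a path of length N, ending in some level set \<open>c\<close>,
  followed by one admissible step from \<open>c\<close> to \<open>b\<close>.\<close>

lemma colourings_Suc:
  assumes b: "b \<subseteq> {1..k}"
  shows "colourings k u (Suc N) a b =
    (\<Union>c\<in>{c \<in> Pow {1..k}. colours_match k (u N) c b}.
      (\<lambda>U. U \<union> b \<times> {Suc N}) ` colourings k u N a c)"
    (is "?L = ?R")
proof (intro subset_antisym subsetI)
  fix U assume U: "U \<in> ?L"
  define U' where "U' = U \<inter> UNIV \<times> {..N}"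
  have lev: "colour_level U' j = colour_level U j" if "j \<le> N" for j
    using that by (auto simp: U'_def colour_level_def)
  have "U = U' \<union> b \<times> {Suc N}"
    using U by (auto simp: colourings_def U'_def colour_level_def le_Suc_eq)
  moreover have "U' \<in> colourings k u N a (colour_level U N)"
    using U lev by (auto simp: colourings_def U'_def)
  moreover have "colours_match k (u N) (colour_level U N) b"
    using U by (auto simp: colourings_def)
  moreover have "colour_level U N \<subseteq> {1..k}"
    using U by (auto simp: colourings_def colour_level_def)
  ultimately show "U \<in> ?R" by blast
next
  fix U assume "U \<in> ?R"
  then obtain c U' where c: "colours_match k (u N) c b" "U' \<in> colourings k u N a c"
    and U: "U = U' \<union> b \<times> {Suc N}" by blast
  have lev: "colour_level U j = colour_level U' j" if "j \<le> N" for j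
    using that by (auto simp: U colour_level_def)
  have top: "colour_level U (Suc N) = b"
    using c(2) by (auto simp: U colour_level_def colourings_def)
  have "colours_match k (u j) (colour_level U j) (colour_level U (Suc j))" if "j < Suc N" for j
  proof (cases "j = N")
    case True
    then show ?thesis using c lev[of N] top by (simp add: colourings_def)
  next
    case False
    then show ?thesis using c that lev[of j] lev[of "Suc j"] by (auto simp: colourings_def)
  qed
  moreover have "U \<subseteq> {1..k} \<times> {..Suc N}"
    using c(2) b by (auto simp: U colourings_def)
  moreover have "colour_level U 0 = a"
    using c(2) lev[of 0] by (simp add: colourings_def)
  ultimately show "U \<in> ?L" using top by (simp add: colourings_def)
qed

text \<open>Matrix products count paths. The pieces for different \<open>c\<close> are disjoint
  because \<open>c\<close> can be read off from level \<open>N\<close>.\<close>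

lemma card_colourings:
  assumes "a \<subseteq> {1..k}" and "b \<subseteq> {1..k}"
  shows "card (colourings k u N a b) = colouring_count k u N a b"
  using assms(2)
proof (induction N arbitrary: b)
  case 0
  have "colourings k u 0 a b = (if a = b then {a \<times> {0}} else {})"
    using assms(1) by (auto simp: colourings_def colour_level_def)
  then show ?case by simp
next
  case (Suc N)
  let ?f = "\<lambda>U. U \<union> b \<times> {Suc N}" and ?C = "{c \<in> Pow {1..k}. colours_match k (u N) c b}"
  \<comment> \<open>Adding the top level is undone by cutting back to the levels up to
    \<open>N\<close>, so it is injective even across different \<open>c\<close>.\<close>
  have below: "U = ?f U \<inter> UNIV \<times> {..N}" if "U \<in> colourings k u N a c" for U c
    using that by (auto simp: colourings_def)
  have inj: "U = U'" if "U \<in> colourings k u N a c" "U' \<in> colourings k u N a c'" "?f U = ?f U'"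
    for U U' c c'
    using below[OF that(1)] below[OF that(2)] that(3) by simp
  have "card (colourings k u (Suc N) a b) = (\<Sum>c\<in>?C. card (?f ` colourings k u N a c))"
    unfolding colourings_Suc[OF Suc.prems]
  proof (rule card_UN_disjoint; (intro ballI impI)?)
    fix c c' :: "nat set" assume "c \<noteq> c'"
    have "c = c'" if "U \<in> colourings k u N a c" "U' \<in> colourings k u N a c'" "?f U = ?f U'" for U U'
      using inj[OF that] that(1,2) by (simp add: colourings_def)
    then show "?f ` colourings k u N a c \<inter> ?f ` colourings k u N a c' = {}"
      using \<open>c \<noteq> c'\<close> by blast
  qed simp_all
  also have "\<dots> = (\<Sum>c\<in>?C. card (colourings k u N a c))"
    by (intro sum.cong refl card_image inj_onI) (rule inj)
  also have "\<dots> = (\<Sum>c\<in>?C. colouring_count k u N a c)"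
    by (intro sum.cong refl Suc.IH) auto
  also have "\<dots> = colouring_count k u (Suc N) a b"
    unfolding colouring_count.simps by (subst sum.inter_filter, simp, intro sum.cong refl) simp
  finally show ?case .
qed

text \<open>The test is the one in \<open>state_arcs\<close>: A-smoothed positive and B-smoothed
  negative crossings are vertical.\<close>

definition smoothing :: "braid_word \<Rightarrow> nat set \<Rightarrow> nat \<Rightarrow> nat option" where
  "smoothing w S j = (if snd (w ! j) \<longleftrightarrow> j \<in> S then None else Some (fst (w ! j)))"

text \<open>The arcs of one crossing only see positions 1 to k, whereas a vertical match demands
  equality of whole level sets; the bound on \<open>U\<close> reconciles the two.\<close>

lemma smoothing_arcs_respected:
  assumes "U \<subseteq> {1..k} \<times> V"
  shows "(\<forall>(x, y)\<in>smoothing_arcs k i v j. x \<in> U \<longleftrightarrow> y \<in> U) \<longleftrightarrow>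
    colours_match k (if v then None else Some i) (colour_level U j) (colour_level U (Suc j))"
proof (cases v)
  case True
  then show ?thesis
    using assms by (auto simp: smoothing_arcs_def colour_level_def)
next
  case False
  then show ?thesis by (auto simp: smoothing_arcs_def colour_level_def)
qed

lemma state_arcs_subset:
  assumes "fst ` set w \<subseteq> {1..<k}"
  shows "state_arcs k w S \<subseteq> ({1..k} \<times> {..length w}) \<times> ({1..k} \<times> {..length w})"
proof -
  have "1 \<le> fst (w ! j)" "Suc (fst (w ! j)) \<le> k" if "j < length w" for j
    using assms nth_mem[OF that] by force+
  then show ?thesis
    by (fastforce simp: state_arcs_def smoothing_arcs_def split: if_splits)
qed

text \<open>The closing arcs force the last level set to equal the first, so the two-colourings
  constant on circles are the closed paths, counted by the trace of the transfer matrix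
  product.\<close>

lemma two_power_state_circles:
  assumes "fst ` set w \<subseteq> {1..<k}"
  shows "2 ^ state_circles k w S =
    (\<Sum>a\<in>Pow {1..k}. colouring_count k (smoothing w S) (length w) a a)"
proof -
  let ?N = "length w" and ?V = "{1..k} \<times> {..length w}"
  have closing: "(\<forall>(x, y)\<in>{((p, ?N), (p, 0)) | p. p \<in> {1..k}}. x \<in> U \<longleftrightarrow> y \<in> U) \<longleftrightarrow>
      colour_level U ?N = colour_level U 0" if "U \<subseteq> ?V" for U
    using that by (auto simp: colour_level_def)
  have respected: "(\<forall>(x, y)\<in>state_arcs k w S. x \<in> U \<longleftrightarrow> y \<in> U) \<longleftrightarrow>
      U \<in> (\<Union>a\<in>Pow {1..k}. colourings k (smoothing w S) ?N a a)" if U: "U \<subseteq> ?V" for U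
  proof -
    have "(\<forall>(x, y)\<in>state_arcs k w S. x \<in> U \<longleftrightarrow> y \<in> U) \<longleftrightarrow>
        (\<forall>j<?N. colours_match k (smoothing w S j) (colour_level U j) (colour_level U (Suc j))) \<and>
        colour_level U ?N = colour_level U 0"
      unfolding state_arcs_def ball_Un closing[OF U]
      by (simp only: smoothing_def UN_iff ball_UN smoothing_arcs_respected[OF U]) auto
    moreover have "colour_level U 0 \<subseteq> {1..k}"
      using U by (auto simp: colour_level_def)
    ultimately show ?thesis using U by (auto simp: colourings_def)
  qed
  have inside: "U \<subseteq> ?V" if "U \<in> colourings k (smoothing w S) ?N a a" for U a
    using that by (auto simp: colourings_def)
  have "{U. U \<subseteq> ?V \<and> (\<forall>(x, y)\<in>state_arcs k w S. x \<in> U \<longleftrightarrow> y \<in> U)} =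
      (\<Union>a\<in>Pow {1..k}. colourings k (smoothing w S) ?N a a)"
  proof (intro set_eqI iffI)
    fix U assume "U \<in> {U. U \<subseteq> ?V \<and> (\<forall>(x, y)\<in>state_arcs k w S. x \<in> U \<longleftrightarrow> y \<in> U)}"
    then show "U \<in> (\<Union>a\<in>Pow {1..k}. colourings k (smoothing w S) ?N a a)"
      using respected[of U] by simp
  next
    fix U assume U: "U \<in> (\<Union>a\<in>Pow {1..k}. colourings k (smoothing w S) ?N a a)"
    then have "U \<subseteq> ?V" using inside by (auto simp only: UN_iff)
    then show "U \<in> {U. U \<subseteq> ?V \<and> (\<forall>(x, y)\<in>state_arcs k w S. x \<in> U \<longleftrightarrow> y \<in> U)}"
      using respected[of U] U by simp
  qed
  then have "2 ^ state_circles k w S =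
      card (\<Union>a\<in>Pow {1..k}. colourings k (smoothing w S) ?N a a)"
    unfolding state_circles_def
    by (subst card_saturated_subsets[symmetric]) (use state_arcs_subset[OF assms] in auto)
  also have "\<dots> = (\<Sum>a\<in>Pow {1..k}. card (colourings k (smoothing w S) ?N a a))"
    by (intro card_UN_disjoint) (auto simp: colourings_def[of k "smoothing w S"])
  also have "\<dots> = (\<Sum>a\<in>Pow {1..k}. colouring_count k (smoothing w S) ?N a a)"
    by (intro sum.cong refl card_colourings) auto
  finally show ?thesis .
qed

section \<open>The Temperley-Lieb algebra on three strands\<close>

text \<open>The five planar diagrams on three strands (the third Catalan number), a basis of the
  Temperley-Lieb algebra.\<close>

datatype tl3 = TL1 | TLe1 | TLe2 | TLe1e2 | TLe2e1

text \<open>Colourings \<open>a\<close> of the lower and \<open>b\<close> of the upper endpoints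
  that are constant on each arc of the diagram.\<close>

fun tl3_joins :: "tl3 \<Rightarrow> nat set \<Rightarrow> nat set \<Rightarrow> bool" where
  "tl3_joins TL1 a b \<longleftrightarrow> (1 \<in> a \<longleftrightarrow> 1 \<in> b) \<and> (2 \<in> a \<longleftrightarrow> 2 \<in> b) \<and> (3 \<in> a \<longleftrightarrow> 3 \<in> b)"
| "tl3_joins TLe1 a b \<longleftrightarrow> (1 \<in> a \<longleftrightarrow> 2 \<in> a) \<and> (1 \<in> b \<longleftrightarrow> 2 \<in> b) \<and> (3 \<in> a \<longleftrightarrow> 3 \<in> b)"
| "tl3_joins TLe2 a b \<longleftrightarrow> (2 \<in> a \<longleftrightarrow> 3 \<in> a) \<and> (2 \<in> b \<longleftrightarrow> 3 \<in> b) \<and> (1 \<in> a \<longleftrightarrow> 1 \<in> b)"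
| "tl3_joins TLe1e2 a b \<longleftrightarrow> (1 \<in> a \<longleftrightarrow> 2 \<in> a) \<and> (2 \<in> b \<longleftrightarrow> 3 \<in> b) \<and> (3 \<in> a \<longleftrightarrow> 1 \<in> b)"
| "tl3_joins TLe2e1 a b \<longleftrightarrow> (2 \<in> a \<longleftrightarrow> 3 \<in> a) \<and> (1 \<in> b \<longleftrightarrow> 2 \<in> b) \<and> (1 \<in> a \<longleftrightarrow> 3 \<in> b)"

text \<open>The two-dimensional representation: the matrices satisfy e_i^2 = \<delta> e_i, e_1 e_2
  e_1 = e_1 and e_2 e_1 e_2 = e_2.\<close>

definition tl_matrix :: "'a::comm_ring_1 \<Rightarrow> nat option \<Rightarrow> 'a mat2" where
  "tl_matrix \<delta> g =
    (case g of None \<Rightarrow> 1 | Some i \<Rightarrow> if i = 1 then Mat2 \<delta> 1 0 0 else Mat2 0 0 1 \<delta>)"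

fun tl3_matrix :: "'a::comm_ring_1 \<Rightarrow> tl3 \<Rightarrow> 'a mat2" where
  "tl3_matrix \<delta> TL1 = 1"
| "tl3_matrix \<delta> TLe1 = Mat2 \<delta> 1 0 0"
| "tl3_matrix \<delta> TLe2 = Mat2 0 0 1 \<delta>"
| "tl3_matrix \<delta> TLe1e2 = Mat2 1 \<delta> 0 0"
| "tl3_matrix \<delta> TLe2e1 = Mat2 0 0 \<delta> 1"

text \<open>The second component is the number of loops split off by the multiplication.\<close>

fun tl3_mult :: "tl3 \<Rightarrow> nat \<Rightarrow> tl3 \<times> nat" where
  "tl3_mult TL1 i = (if i = 1 then (TLe1, 0) else (TLe2, 0))"
| "tl3_mult TLe1 i = (if i = 1 then (TLe1, 1) else (TLe1e2, 0))"
| "tl3_mult TLe2 i = (if i = 1 then (TLe2e1, 0) else (TLe2, 1))"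
| "tl3_mult TLe1e2 i = (if i = 1 then (TLe1, 0) else (TLe1e2, 1))"
| "tl3_mult TLe2e1 i = (if i = 1 then (TLe2e1, 1) else (TLe2, 0))"

lemma tl3_matrix_mult:
  assumes "i = 1 \<or> i = 2" and "tl3_mult d i = (d', l)"
  shows "tl3_matrix \<delta> d * tl_matrix \<delta> (Some i) = mat2_scalar (\<delta> ^ l) * tl3_matrix \<delta> d'"
  using assms
  by (cases d) (auto simp: tl_matrix_def mat2_scalar_def one_mat2_def times_mat2_def split: if_splits)

lemma sum_Pow_three:
  "(\<Sum>c\<in>Pow {1..3::nat}. f c) =
    f {} + f {3} + (f {2} + f {2, 3}) + (f {1} + f {1, 3} + (f {1, 2} + f {1, 2, 3}))"
proof -
  have *: "(\<Sum>c\<in>Pow (insert x X). f c) = (\<Sum>c\<in>Pow X. f c) + (\<Sum>c\<in>Pow X. f (insert x c))"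
    if "finite X" "x \<notin> X" for x :: nat and X and f :: "nat set \<Rightarrow> 'a"
  proof -
    have "(\<Sum>c\<in>Pow (insert x X). f c) = (\<Sum>c\<in>Pow X. f c) + (\<Sum>c\<in>insert x ` Pow X. f c)"
      unfolding Pow_insert using that by (intro sum.union_disjoint) auto
    also have "(\<Sum>c\<in>insert x ` Pow X. f c) = (\<Sum>c\<in>Pow X. f (insert x c))"
      using that by (subst sum.reindex) (auto simp: inj_on_def insert_ident)
    finally show ?thesis .
  qed
  have "{1..3::nat} = {1, 2, 3}" by auto
  then show ?thesis by (simp add: *)
qed

lemma colours_match_three:
  "colours_match 3 (Some 1) a b \<longleftrightarrow>
    (1 \<in> a \<longleftrightarrow> 2 \<in> a) \<and> (1 \<in> b \<longleftrightarrow> 2 \<in> b) \<and> (3 \<in> a \<longleftrightarrow> 3 \<in> b)"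
  "colours_match 3 (Some 2) a b \<longleftrightarrow>
    (2 \<in> a \<longleftrightarrow> 3 \<in> a) \<and> (2 \<in> b \<longleftrightarrow> 3 \<in> b) \<and> (1 \<in> a \<longleftrightarrow> 1 \<in> b)"
proof -
  have "{1..3} - {1, Suc 1} = {3::nat}" "{1..3} - {2, Suc 2} = {1::nat}" by auto
  moreover have "Suc 1 = 2" "Suc 2 = 3" by simp_all
  ultimately show
    "colours_match 3 (Some 1) a b \<longleftrightarrow>
      (1 \<in> a \<longleftrightarrow> 2 \<in> a) \<and> (1 \<in> b \<longleftrightarrow> 2 \<in> b) \<and> (3 \<in> a \<longleftrightarrow> 3 \<in> b)"
    "colours_match 3 (Some 2) a b \<longleftrightarrow>
      (2 \<in> a \<longleftrightarrow> 3 \<in> a) \<and> (2 \<in> b \<longleftrightarrow> 3 \<in> b) \<and> (1 \<in> a \<longleftrightarrow> 1 \<in> b)"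
    by (simp_all only: colours_match.simps ball_simps simp_thms)
qed

text \<open>When \<open>d\<close> and e_i are glued, the colours of the middle points are forced by
  \<open>a\<close> and \<open>b\<close>, except on a loop that closes up there; such a loop has two
  free colours.\<close>

lemma tl3_joins_mult:
  assumes "i = 1 \<or> i = 2" and "tl3_mult d i = (d', l)"
  shows "(\<Sum>c\<in>Pow {1..3}. of_bool (tl3_joins d a c) * of_bool (colours_match 3 (Some i) c b)) =
    2 ^ l * (of_bool (tl3_joins d' a b) :: nat)"
proof -
  have distinct: "(1::nat) \<noteq> 2" "(2::nat) \<noteq> 1" "(1::nat) \<noteq> 3" "(3::nat) \<noteq> 1" "(2::nat) \<noteq> 3" "(3::nat) \<noteq> 2"
    by simp_all
  note bool_sum = of_bool_eq mult_zero_left mult_zero_right mult_1_left add_0_left add_0_right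
  have "d' = fst (tl3_mult d i)" "l = snd (tl3_mult d i)" using assms(2) by simp_all
  then show ?thesis
    unfolding sum_Pow_three
    using assms(1)
    \<comment> \<open>A finite check: ten products, each against the 64 membership patterns of 1, 2,
      3 in \<open>a\<close> and \<open>b\<close>.\<close>
    by (elim disjE; (cases d; (simp only: tl3_mult.simps fst_conv snd_conv tl3_joins.simps
        colours_match_three insert_iff empty_iff distinct simp_thms if_True if_False;
       (cases "1 \<in> a"; (cases "2 \<in> a"; (cases "3 \<in> a";
       (cases "1 \<in> b"; (cases "2 \<in> b"; (cases "3 \<in> b";
       (simp only: simp_thms bool_sum power_0 power_one_right one_add_one))))))))))
qed

text \<open>One diagram \<open>d\<close> and one loop number \<open>l\<close> describe the state
  both in the colouring count, where a loop is worth 2, and in the representation, where it is worth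
  \<delta>. The last conjunct singles out the state that needs a correction in the trace
  formula.\<close>

lemma state_reduces_to_tl3:
  assumes "\<And>j. j < N \<Longrightarrow> u j \<in> {None, Some 1, Some 2}"
  shows "\<exists>d l. (\<forall>a\<in>Pow {1..3}. \<forall>b\<in>Pow {1..3}.
        colouring_count 3 u N a b = 2 ^ l * of_bool (tl3_joins d a b)) \<and>
      prod_list (map (\<lambda>j. tl_matrix \<delta> (u j)) [0..<N]) = mat2_scalar (\<delta> ^ l) * tl3_matrix \<delta> d \<and>
      (if \<forall>j<N. u j = None then d = TL1 \<and> l = 0 else d \<noteq> TL1)"
  using assms
proof (induction N)
  case 0
  have "a = b \<longleftrightarrow> tl3_joins TL1 a b" if "a \<in> Pow {1..3}" "b \<in> Pow {1..3}" for a b :: "nat set"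
  proof -
    have "a \<subseteq> {1, 2, 3}" "b \<subseteq> {1, 2, 3}" using that by force+
    then show ?thesis by auto
  qed
  then show ?case by (intro exI[of _ TL1] exI[of _ 0]) simp
next
  case (Suc N)
  from Suc.IH Suc.prems obtain d l where
    count: "\<And>a b. a \<subseteq> {1..3} \<Longrightarrow> b \<subseteq> {1..3} \<Longrightarrow>
      colouring_count 3 u N a b = 2 ^ l * of_bool (tl3_joins d a b)" and
    matrix: "prod_list (map (\<lambda>j. tl_matrix \<delta> (u j)) [0..<N]) =
      mat2_scalar (\<delta> ^ l) * tl3_matrix \<delta> d" and
    trivial: "if \<forall>j<N. u j = None then d = TL1 \<and> l = 0 else d \<noteq> TL1"
    by (metis (no_types, lifting) PowI less_SucI)
  show ?case
  proof (cases "u N")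
    case None
    have "colouring_count 3 u (Suc N) a b = colouring_count 3 u N a b" if "b \<subseteq> {1..3}" for a b
      using that None by (simp add: if_distrib sum.delta cong: if_cong)
    then show ?thesis
      using count matrix trivial None
      by (intro exI[of _ d] exI[of _ l]) (auto simp: less_Suc_eq tl_matrix_def)
  next
    case (Some i)
    then have i: "i = 1 \<or> i = 2" using Suc.prems[of N] by auto
    obtain d' l' where m: "tl3_mult d i = (d', l')" by fastforce
    have "colouring_count 3 u (Suc N) a b = 2 ^ (l + l') * of_bool (tl3_joins d' a b)"
      if ab: "a \<subseteq> {1..3}" "b \<subseteq> {1..3}" for a b
    proof -
      have "colouring_count 3 u (Suc N) a b =
          (\<Sum>c\<in>Pow {1..3}. 2 ^ l * (of_bool (tl3_joins d a c) * of_bool (colours_match 3 (Some i) c b)))"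
        unfolding colouring_count.simps Some
        by (intro sum.cong refl) (use ab count in \<open>simp add: mult.assoc del: colours_match.simps\<close>)
      also have "\<dots> = 2 ^ (l + l') * of_bool (tl3_joins d' a b)"
        unfolding sum_distrib_left[symmetric] tl3_joins_mult[OF i m] by (simp add: power_add)
      finally show ?thesis .
    qed
    moreover have "prod_list (map (\<lambda>j. tl_matrix \<delta> (u j)) [0..<Suc N]) =
        mat2_scalar (\<delta> ^ (l + l')) * tl3_matrix \<delta> d'"
      by (simp add: matrix Some mult.assoc tl3_matrix_mult[OF i m] power_add
          mat2_scalar_mult[symmetric])
    \<comment> \<open>Once a generator occurs, further multiplication never returns to the identity
      diagram.\<close>
    moreover have "d' \<noteq> TL1" using m by (cases d) (auto split: if_splits)
    moreover have "\<not> (\<forall>j<Suc N. u j = None)" using Some by auto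
    ultimately show ?thesis by (intro exI[of _ d'] exI[of _ "l + l'"]) auto
  qed
qed

text \<open>The trace of a diagram matrix is \<delta>^(c-1), with c the circles of its closure, for
  every diagram but the identity: there the trace is 2 while the three circles demand
  \<delta>^2.\<close>

lemma loop_power_eq_trace:
  fixes \<delta> :: "'a::comm_ring_1"
  assumes w: "fst ` set w \<subseteq> {1, 2}"
  shows "\<delta> ^ (state_circles 3 w S - 1) =
    mat2_trace (prod_list (map (\<lambda>j. tl_matrix \<delta> (smoothing w S j)) [0..<length w])) +
    (\<delta> ^ 2 - 2) * of_bool (\<forall>j<length w. smoothing w S j = None)"
proof -
  have letters: "fst (w ! j) \<in> {1, 2}" if "j < length w" for j
    using w nth_mem[OF that] by force
  then have "smoothing w S j \<in> {None, Some 1, Some 2}" if "j < length w" for j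
    using letters[OF that] by (auto simp: smoothing_def)
  from state_reduces_to_tl3[of "length w" "smoothing w S" \<delta>, OF this] obtain d l where
    count: "\<And>a b. a \<subseteq> {1..3} \<Longrightarrow> b \<subseteq> {1..3} \<Longrightarrow>
      colouring_count 3 (smoothing w S) (length w) a b = 2 ^ l * of_bool (tl3_joins d a b)" and
    matrix: "prod_list (map (\<lambda>j. tl_matrix \<delta> (smoothing w S j)) [0..<length w]) =
      mat2_scalar (\<delta> ^ l) * tl3_matrix \<delta> d" and
    trivial: "if \<forall>j<length w. smoothing w S j = None then d = TL1 \<and> l = 0 else d \<noteq> TL1"
    by (metis (no_types, lifting) PowI)
  \<comment> \<open>The number of circles in the closure of \<open>d\<close>, confirmed below by
    counting the \<open>a\<close> with \<open>tl3_joins d a a\<close>.\<close>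
  define c :: nat where "c = (case d of TL1 \<Rightarrow> 3 | TLe1 \<Rightarrow> 2 | TLe2 \<Rightarrow> 2 | _ \<Rightarrow> 1)"
  have w': "fst ` set w \<subseteq> {1..<3}" using w by auto
  have "2 ^ state_circles 3 w S = (\<Sum>a\<in>Pow {1..3}. 2 ^ l * of_bool (tl3_joins d a a) :: nat)"
    unfolding two_power_state_circles[OF w'] by (intro sum.cong refl count) auto
  also have "\<dots> = 2 ^ (l + c)"
    unfolding sum_distrib_left[symmetric] sum_Pow_three by (cases d) (simp_all add: c_def power_add)
  finally have circles: "state_circles 3 w S = l + c" by simp
  show ?thesis
    using trivial
    by (cases d) (auto simp: matrix circles c_def mat2_trace_def one_mat2_def mat2_scalar_def
        times_mat2_def power2_eq_square split: if_splits)
qed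

section \<open>The bracket of a closed 3-braid\<close>

text \<open>Expansion of an ordered product of sums, with \<open>S\<close> recording where the first
  summand is chosen. Lists keep the order, as the factors need not commute.\<close>

lemma sum_Pow_prod_list:
  fixes f g :: "nat \<Rightarrow> 'a::semiring_1"
  shows "(\<Sum>S\<in>Pow {..<N}. prod_list (map (\<lambda>j. if j \<in> S then f j else g j) [0..<N])) =
    prod_list (map (\<lambda>j. f j + g j) [0..<N])"
proof (induction N)
  case (Suc N)
  let ?h = "\<lambda>S j. if j \<in> S then f j else g j"
  let ?P = "\<lambda>N S. prod_list (map (?h S) [0..<N])"
  have "(\<Sum>S\<in>Pow {..<Suc N}. ?P (Suc N) S) =
      (\<Sum>S\<in>Pow {..<N}. ?P (Suc N) S) + (\<Sum>S\<in>insert N ` Pow {..<N}. ?P (Suc N) S)"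
    unfolding lessThan_Suc Pow_insert by (intro sum.union_disjoint) auto
  also have "(\<Sum>S\<in>insert N ` Pow {..<N}. ?P (Suc N) S) = (\<Sum>S\<in>Pow {..<N}. ?P (Suc N) (insert N S))"
    by (subst sum.reindex) (auto simp: inj_on_def insert_ident)
  also have "\<dots> = (\<Sum>S\<in>Pow {..<N}. ?P N S * f N)"
  proof (intro sum.cong refl)
    fix S
    have "?P (Suc N) (insert N S) = ?P N (insert N S) * f N" by simp
    \<comment> \<open>Indices below \<open>N\<close> do not notice whether \<open>N\<close> belongs
      to the state.\<close>
    also have "map (?h (insert N S)) [0..<N] = map (?h S) [0..<N]" by simp
    finally show "?P (Suc N) (insert N S) = ?P N S * f N" .
  qed
  also have "(\<Sum>S\<in>Pow {..<N}. ?P (Suc N) S) = (\<Sum>S\<in>Pow {..<N}. ?P N S * g N)"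
    by (intro sum.cong refl) auto
  finally show ?case
    using Suc by (simp add: distrib_left add.commute flip: sum_distrib_right)
qed simp

text \<open>Splits the weight of a state into one factor per crossing, ready to be absorbed into the
  matrices.\<close>

lemma powi_card_diff_eq_prod_list:
  fixes A :: "'a::field"
  assumes "A \<noteq> 0" and "S \<subseteq> {..<N}"
  shows "A powi (int (card S) - int (card ({..<N} - S))) =
    prod_list (map (\<lambda>j. if j \<in> S then A else inverse A) [0..<N])"
proof -
  have "prod_list (map (\<lambda>j. if j \<in> S then A else inverse A) [0..<N]) =
      (\<Prod>j\<in>{..<N}. if j \<in> S then A else inverse A)"
    by (subst prod.distinct_set_conv_list[symmetric]) (auto simp: atLeast0LessThan)
  also have "\<dots> = A ^ card S * inverse A ^ card ({..<N} - S)"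
    using assms(2) by (simp add: prod.If_cases Int_absorb1 Diff_eq)
  finally show ?thesis
    using assms(1) by (simp add: power_int_diff power_inverse divide_inverse)
qed

text \<open>The skein relation: \<sigma>_i becomes A + A^(-1) e_i, and its inverse the same with A
  and A^(-1) exchanged. On the generators this is A times a diagonal conjugate of the Burau matrix
  at t = A^(-4).\<close>

definition braid_matrix :: "'a::field \<Rightarrow> nat \<times> bool \<Rightarrow> 'a mat2" where
  "braid_matrix A x =
    (let B = if snd x then A else inverse A; \<delta> = - (A ^ 2) - A powi (- 2)
     in mat2_scalar B + mat2_scalar (inverse B) * tl_matrix \<delta> (Some (fst x)))"

lemma prod_list_map_mult:
  "prod_list (map (\<lambda>j. mat2_scalar (f j) * g j) xs) =
    mat2_scalar (prod_list (map f xs)) * prod_list (map g xs)"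
proof (induction xs)
  case (Cons x xs)
  let ?F = "mat2_scalar (prod_list (map f xs))" and ?G = "prod_list (map g xs)"
  have "mat2_scalar (f x) * g x * (?F * ?G) = mat2_scalar (f x) * (g x * ?F) * ?G"
    by (simp add: mult.assoc)
  also have "\<dots> = (mat2_scalar (f x) * ?F) * (g x * ?G)"
    by (simp only: mat2_scalar_commute[of "g x"] mult.assoc)
  finally show ?case by (simp add: Cons mat2_scalar_mult)
qed simp

text \<open>Only the state all of whose smoothings are vertical contributes to the second summand.\<close>

theorem kauffman_bracket_three_braid:
  fixes A :: "'a::field"
  assumes A: "A \<noteq> 0" and w: "fst ` set w \<subseteq> {1, 2}"
  shows "kauffman_bracket A 3 w =
    mat2_trace (prod_list (map (braid_matrix A) w)) + (A ^ 4 + A powi (- 4)) * A powi writhe w"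
proof -
  let ?N = "length w" and ?\<delta> = "- (A ^ 2) - A powi (- 2)"
  let ?a = "\<lambda>S j. if j \<in> S then A else inverse A"
  let ?M = "\<lambda>S j. tl_matrix ?\<delta> (smoothing w S j)"
  let ?wt = "\<lambda>S. prod_list (map (?a S) [0..<?N])"
  \<comment> \<open>The one state in which every smoothing is vertical.\<close>
  let ?S0 = "{j. j < ?N \<and> snd (w ! j)}"
  let ?up = "\<lambda>j. mat2_scalar A * tl_matrix ?\<delta> (if snd (w ! j) then None else Some (fst (w ! j)))"
  let ?down = "\<lambda>j. mat2_scalar (inverse A) *
    tl_matrix ?\<delta> (if snd (w ! j) then Some (fst (w ! j)) else None)"
  have "kauffman_bracket A 3 w = (\<Sum>S\<in>Pow {..<?N}. ?wt S *
      (mat2_trace (prod_list (map (?M S) [0..<?N])) +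
        (?\<delta> ^ 2 - 2) * of_bool (\<forall>j<?N. smoothing w S j = None)))"
    unfolding kauffman_bracket_def loop_power_eq_trace[OF w]
    by (intro sum.cong refl) (subst powi_card_diff_eq_prod_list[OF A], auto)
  also have "\<dots> = (\<Sum>S\<in>Pow {..<?N}. ?wt S * mat2_trace (prod_list (map (?M S) [0..<?N]))) +
      (\<Sum>S\<in>Pow {..<?N}. if S = ?S0 then ?wt S * (?\<delta> ^ 2 - 2) else 0)"
    unfolding distrib_left sum.distrib
  proof (intro arg_cong2[of _ _ _ _ "(+)"] sum.cong refl)
    fix S assume "S \<in> Pow {..<?N}"
    then have "(\<forall>j<?N. smoothing w S j = None) \<longleftrightarrow> S = ?S0"
      by (auto simp: smoothing_def split: if_splits)
    then show "?wt S * ((?\<delta> ^ 2 - 2) * of_bool (\<forall>j<?N. smoothing w S j = None)) =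
        (if S = ?S0 then ?wt S * (?\<delta> ^ 2 - 2) else 0)" by simp
  qed
  \<comment> \<open>Central weights merge with the matrices crossing by crossing; the state sum is
    then the expansion of the product of the skein matrices.\<close>
  also have "(\<Sum>S\<in>Pow {..<?N}. ?wt S * mat2_trace (prod_list (map (?M S) [0..<?N]))) =
      mat2_trace (\<Sum>S\<in>Pow {..<?N}. prod_list (map (\<lambda>j. if j \<in> S then ?up j else ?down j) [0..<?N]))"
    unfolding mat2_trace_sum mat2_trace_scalar_mult[symmetric] prod_list_map_mult[symmetric]
    by (intro sum.cong refl arg_cong[of _ _ mat2_trace] arg_cong[of _ _ prod_list] map_cong)
      (auto simp: smoothing_def)
  also have "\<dots> = mat2_trace (prod_list (map (\<lambda>j. braid_matrix A (w ! j)) [0..<?N]))"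
    unfolding sum_Pow_prod_list
    by (intro arg_cong[of _ _ mat2_trace] arg_cong[of _ _ prod_list] map_cong refl)
      (auto simp: braid_matrix_def Let_def tl_matrix_def add.commute)
  also have "map (\<lambda>j. braid_matrix A (w ! j)) [0..<?N] = map (braid_matrix A) w"
    by (rule nth_equalityI) auto
  also have "(\<Sum>S\<in>Pow {..<?N}. if S = ?S0 then ?wt S * (?\<delta> ^ 2 - 2) else 0) = ?wt ?S0 * (?\<delta> ^ 2 - 2)"
    by (simp add: sum.delta subset_eq)
  \<comment> \<open>In this state positive crossings contribute A and negative ones A^(-1), which
    gives the writhe as exponent.\<close>
  also have "?wt ?S0 = prod_list (map (\<lambda>x. if snd x then A else inverse A) w)"
    by (intro arg_cong[of _ _ prod_list] nth_equalityI) auto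
  also have "\<dots> = A powi writhe w"
    using A by (induction w) (simp_all add: writhe_def power_int_add power_int_diff field_simps)
  also have "?\<delta> ^ 2 - 2 = A ^ 4 + A powi (- 4)"
    using A by (simp add: power_int_minus power2_eq_square power4_eq_xxxx field_simps)
  finally show ?thesis by (simp add: mult.commute)
qed

section \<open>Weaving links\<close>

lemma set_weaving_braid: "fst ` set (weaving_braid n m) \<subseteq> {1, 2}"
  by (auto simp: weaving_braid_def)

lemma writhe_append: "writhe (v @ w) = writhe v + writhe w"
  by (simp add: writhe_def)

text \<open>Each block has m positive and m negative letters. Hence the normalising factor of the
  Jones polynomial is 1 and the correction term of the bracket is constant.\<close>

lemma writhe_weaving_braid: "writhe (weaving_braid n m) = 0"
proof (induction n)
  case (Suc n)
  have "weaving_braid (Suc n) m = (replicate m (1, True) @ replicate m (2, False)) @ weaving_braid n m"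
    by (simp add: weaving_braid_def)
  moreover have "writhe (replicate m (1, True) @ replicate m (2, False)) = 0"
    by (simp add: writhe_def sum_list_replicate)
  ultimately show ?case using Suc by (simp only: writhe_append)
qed (simp add: weaving_braid_def writhe_def)

lemma prod_list_weaving_braid:
  "prod_list (map f (weaving_braid n m)) = (f (1, True) ^ m * f (2, False) ^ m) ^ n"
  by (induction n) (simp_all add: weaving_braid_def prod_list_replicate mult.assoc)

text \<open>The loop value collapses A + A^(-1) \<delta> to -A^(-3) and A^(-1) + A \<delta> to -A^3,
  leaving triangular matrices.\<close>

lemma braid_matrix_generators:
  assumes "A \<noteq> 0"
  shows "braid_matrix A (1, True) = Mat2 (- (inverse A ^ 3)) (inverse A) 0 A"
    and "braid_matrix A (2, False) = Mat2 (inverse A) 0 A (- (A ^ 3))"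
  using assms
  by (simp_all add: braid_matrix_def tl_matrix_def mat2_scalar_def plus_mat2_def times_mat2_def
      power_int_minus power2_eq_square power3_eq_cube field_simps)

text \<open>The block matrix \<open>P\<close> has determinant 1 and trace twice the Chebyshev
  argument. The hypothesis that s is not 1 keeps the eigenvalues of each generator distinct, as the
  triangular power formulas require.\<close>

theorem kauffman_bracket_weaving_braid:
  fixes A s :: "'a::field"
  assumes A: "A \<noteq> 0" and s: "s = - (inverse A ^ 4)" "s \<noteq> 1" and two: "(2 :: 'a) \<noteq> 0"
  shows "kauffman_bracket A 3 (weaving_braid n m) = - s - inverse s +
    2 * chebyshev_T n ((1 + ((1 - s ^ m) / (1 - s)) ^ 2 * s + s ^ (2 * m)) / (2 * s ^ m))"
    (is "_ = _ + 2 * chebyshev_T n ?c")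
proof -
  define P where "P = braid_matrix A (1, True) ^ m * braid_matrix A (2, False) ^ m"
  have s0: "s \<noteq> 0" using A s by simp
  \<comment> \<open>Written with s, the eigenvalues of each factor have ratio s, so the geometric
    sums become multiples of [m].\<close>
  have As: "inverse A ^ 3 = - (s * A)" "A ^ 3 = - (inverse A * inverse s)"
    using A unfolding s(1) by (simp_all add: field_simps power4_eq_xxxx power3_eq_cube)
  have pos: "braid_matrix A (1, True) = Mat2 (s * A) (inverse A) 0 A"
    and neg: "braid_matrix A (2, False) = Mat2 (inverse A) 0 A (inverse A * inverse s)"
    unfolding braid_matrix_generators[OF A] As by simp_all
  \<comment> \<open>The product of the determinants of the two generators; the determinant of
    \<open>P\<close> is its m-th power.\<close>
  have "s * A * A * (inverse A * (inverse A * inverse s)) = 1"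
    using A s0 by (simp add: field_simps)
  then have "mat2_det P = 1"
    unfolding P_def mat2_det_mult mat2_det_power pos neg power_mult_distrib[symmetric]
    by (simp add: mat2_det_def)
  moreover have "mat2_trace P = 2 * ?c"
  proof -
    have ne: "s * A \<noteq> A" "inverse A \<noteq> inverse A * inverse s"
      using A s(2) s0 by (auto simp: field_simps)
    \<comment> \<open>The upper right entry of the first power, A^(m-2) [m]. Its partner
      \<open>r\<close> is A^(2-m) s^(1-m) [m], so the powers of A cancel and the trace receives
      [m]^2 s^(1-m).\<close>
    have q: "inverse A * ((s * A) ^ m - A ^ m) / (s * A - A) =
        A ^ m / A ^ 2 * ((1 - s ^ m) / (1 - s))"
    proof -
      have "s * A - A = A * (s - 1)" "s - 1 \<noteq> 0" "1 - s \<noteq> 0" using s(2) by (simp_all add: algebra_simps)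
      then show ?thesis using A by (simp add: field_simps power_mult_distrib power2_eq_square)
    qed
    have r: "A * (inverse A ^ m - (inverse A * inverse s) ^ m) / (inverse A - inverse A * inverse s) =
        A ^ 2 / A ^ m * s / s ^ m * ((1 - s ^ m) / (1 - s))"
    proof -
      have "inverse A - inverse A * inverse s = (s - 1) / (A * s)" "s - 1 \<noteq> 0" "1 - s \<noteq> 0"
        using A s(2) s0 by (simp_all add: field_simps)
      then show ?thesis using A s0
        by (simp add: field_simps power_mult_distrib power2_eq_square power_inverse)
    qed
    have halve: "x + y * s / x + inverse x = 2 * ((1 + y * s + x ^ 2) / (2 * x))" if "x \<noteq> 0" for x y
      using that two by (simp add: field_simps power2_eq_square)
    have cancel: "A ^ m * (x * inverse (A ^ m)) = x" "A ^ m * (inverse (A ^ m) * x) = x" for x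
      using A by simp_all
    have "mat2_trace P = s ^ m + ((1 - s ^ m) / (1 - s)) ^ 2 * s / s ^ m + inverse s ^ m"
      unfolding P_def pos neg mat2_upper_power[OF ne(1)] mat2_lower_power[OF ne(2)] q r
      using A s0
      by (simp add: mat2_trace_def times_mat2_def power_mult_distrib power_inverse power2_eq_square)
        (simp add: mult_ac cancel)
    also have "\<dots> = 2 * ?c"
      using halve[of "s ^ m" "((1 - s ^ m) / (1 - s)) ^ 2", OF power_not_zero[OF s0]]
      by (simp only: power_inverse power_even_eq)
    finally show ?thesis .
  qed
  ultimately have "mat2_trace (P ^ n) = 2 * chebyshev_T n ?c"
    by (rule mat2_trace_power_chebyshev)
  moreover have "A ^ 4 + A powi (- 4) = - s - inverse s"
    using A by (simp add: s power_int_minus power_inverse)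
  ultimately show ?thesis
    by (simp add: kauffman_bracket_three_braid[OF A set_weaving_braid] prod_list_weaving_braid
        writhe_weaving_braid P_def)
qed

text \<open>For A = t^(-1/4) the value -A^(-4) is -t = s, and with writhe 0 the Jones polynomial is
  the bracket itself.\<close>

theorem theorem3p3:
  fixes n m :: nat and s qm :: "rat fls"
  assumes "n \<ge> 1" and "m \<ge> 1"
    and "s = - jones_var"
    and "qm = (1 - s ^ m) / (1 - s)"
  shows "jones_polynomial 3 (weaving_braid n m) =
    - s - inverse s + 2 * chebyshev_T n ((1 + qm ^ 2 * s + s ^ (2 * m)) / (2 * s ^ m))"
proof -
  have s: "s = - (inverse (inverse fls_X) ^ 4)"
    using assms(3) by (simp add: jones_var_def)
  \<comment> \<open>The constant coefficient separates s from 1, so 1 - s may be divided by.\<close>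
  have "fls_nth s 0 = 0"
    using assms(3) by (simp add: jones_var_def fls_X_power_nth)
  then have "s \<noteq> 1" by auto
  then show ?thesis
    unfolding jones_polynomial_def Let_def writhe_weaving_braid assms(4)
    by (simp add: kauffman_bracket_weaving_braid[OF _ s])
qed

end
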